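(* Let $D$ be a DVR with quotient field $K$, prime element $\pi$ and valuation $\mathsf v$, let $n\in\mathbb N_{\ge2}$, and let \[R=\begin{bmatrix} D & \pi^n D \\ D & D \end{bmatrix}\subset M_2(D)\] be an Eichler order of level $n$ in $M_2(K)$. An element \[A=\begin{bmatrix} a & b\pi^n \\ c & d \end{bmatrix}\in R^\bullet\qquad(a,b,c,d\in D)\] is an atom of $R^\bullet$ if and only if one of the following holds: (I) $\mathsf v(\det(A))=1$ (equivalently, $\mathsf v(ad)=1$). (II) $\mathsf v(b)=\mathsf v(c)=0$ and $\mathsf v(a)>0$, $\mathsf v(d)>0$.
   Context: $\mathsf v\colon K\to\mathbb Z\cup\{\infty\}$ is the normalized valuation ($\mathsf v(\pi)=1$, $\mathsf v(0)=\infty$). $R^\bullet$ is the monoid of non-zero-divisors of $R$, i.e. $R^\bullet=\{A\in R:\det(A)\ne0\}$. An atom of a cancellative monoid $H$ is a non-unit $u$ such that $u=xy$ with $x,y\in H$ implies that $x$ or $y$ is a unit of $H$. *)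

theory Defs
  imports "HOL-Analysis.Determinants" "HOL-Library.Extended" "HOL-Algebra.Group"
begin

text \<open>
  A discrete valuation ring \<open>D\<close> is the valuation ring of a discrete valuation of a field \<open>K\<close>;
  here \<open>K\<close> is the type \<open>'k\<close>. The constructors \<open>Fin\<close> and \<open>Pinf\<close> of the type
  \<open>int extended\<close> give the values in \<open>\<int> \<union> {\<infinity>}\<close>. The axiom \<open>v_range\<close> says that \<open>v\<close> is finite
  on nonzero elements, which keeps the third constructor \<open>Minf\<close> out, and that \<open>v\<close> is normalized.
\<close>

locale discrete_valuation_ring =
  fixes D :: "'k::field set" and v :: "'k \<Rightarrow> int extended"
  assumes v_zero: "v 0 = Pinf"
    and v_range: "v ` (UNIV - {0}) = range Fin"
    and v_mult: "v (x * y) = v x + v y"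
    and v_add: "min (v x) (v y) \<le> v (x + y)"
    and D_eq: "D = {x. 0 \<le> v x}"

definition divides_in :: "'k::field set \<Rightarrow> 'k \<Rightarrow> 'k \<Rightarrow> bool" where
  "divides_in D x y \<longleftrightarrow> (\<exists>z\<in>D. y = x * z)"

definition prime_element_of :: "'k::field set \<Rightarrow> 'k \<Rightarrow> bool" where
  "prime_element_of D p \<longleftrightarrow> p \<in> D \<and> p \<noteq> 0 \<and> \<not> divides_in D p 1 \<and>
     (\<forall>x\<in>D. \<forall>y\<in>D. divides_in D p (x * y) \<longrightarrow> divides_in D p x \<or> divides_in D p y)"

definition eichler_order :: "'k::field set \<Rightarrow> 'k \<Rightarrow> nat \<Rightarrow> ('k^2^2) set" where
  "eichler_order D p n = {A. (\<forall>i j. A $ i $ j \<in> D) \<and> (\<exists>b\<in>D. A $ 1 $ 2 = b * p ^ n)}"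

definition non_zero_divisors :: "('a::semiring_1^'n^'n) set \<Rightarrow> ('a^'n^'n) set" where
  "non_zero_divisors R =
     {A \<in> R. \<forall>X\<in>R. (A ** X = 0 \<longrightarrow> X = 0) \<and> (X ** A = 0 \<longrightarrow> X = 0)}"

definition non_zero_divisor_monoid :: "('a::semiring_1^'n^'n) set \<Rightarrow> ('a^'n^'n) monoid" where
  "non_zero_divisor_monoid R = \<lparr>carrier = non_zero_divisors R, mult = (**), one = mat 1\<rparr>"

definition monoid_atom :: "('a, 'b) monoid_scheme \<Rightarrow> 'a \<Rightarrow> bool" where
  "monoid_atom H u \<longleftrightarrow> u \<in> carrier H - Units H \<and>
     (\<forall>x\<in>carrier H. \<forall>y\<in>carrier H. u = x \<otimes>\<^bsub>H\<^esub> y \<longrightarrow> x \<in> Units H \<or> y \<in> Units H)"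

context discrete_valuation_ring
begin

lemma v_finite:
  assumes "x \<noteq> 0"
  obtains k where "v x = Fin k"
  using v_range assms by blast

lemma v_one: "v 1 = 0"
proof -
  obtain k where "v 1 = Fin k" using v_finite zero_neq_one by metis
  then show ?thesis using v_mult[of 1 1] by (simp add: zero_extended_def)
qed

lemma v_minus: "v (- x) = v x"
proof -
  obtain k where k: "v (- 1) = Fin k"
    using v_finite[of "- 1"] by auto
  then have "k = 0" using v_mult[of "- 1" "- 1"] v_one by (simp add: zero_extended_def)
  then show ?thesis using v_mult[of "- 1" x] k by (simp add: zero_extended_def[symmetric])
qed

lemma v_inverse:
  assumes x: "x \<noteq> 0"
  shows "v (inverse x) = - v x"
proof -
  obtain k l where "v x = Fin k" "v (inverse x) = Fin l"
    using v_finite x nonzero_imp_inverse_nonzero by metis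
  then show ?thesis
    using v_mult[of x "inverse x"] v_one x by (simp add: zero_extended_def)
qed

lemma D_zero: "0 \<in> D" and D_one: "1 \<in> D"
  by (simp_all add: D_eq v_zero v_one)

lemma D_mult: "x \<in> D \<Longrightarrow> y \<in> D \<Longrightarrow> x * y \<in> D"
  using add_mono[of "0::int extended" "v x" 0 "v y"] by (simp add: D_eq v_mult)

lemma D_add: "x \<in> D \<Longrightarrow> y \<in> D \<Longrightarrow> x + y \<in> D"
  using v_add[of x y] by (auto simp: D_eq min_def split: if_splits)

lemma D_minus: "x \<in> D \<Longrightarrow> - x \<in> D"
  by (simp add: D_eq v_minus)

lemma quotient_field: "\<exists>a\<in>D. \<exists>b\<in>D - {0}. x = a / b"
proof (cases "x \<in> D")
  case True
  then show ?thesis using D_one by (intro bexI[of _ x] bexI[of _ 1]) auto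
next
  case False
  then have x: "x \<noteq> 0" using D_zero by auto
  then obtain k where "v x = Fin k" by (rule v_finite)
  then have "inverse x \<in> D" using False v_inverse[OF x] by (simp add: D_eq zero_extended_def)
  then show ?thesis using D_one x
    by (intro bexI[of _ 1] bexI[of _ "inverse x"]) (auto simp: field_simps)
qed

lemma v_prime_element:
  assumes p: "prime_element_of D p"
  shows "v p = 1"
proof -
  have p0: "p \<noteq> 0" and pD: "p \<in> D" and nu: "\<not> divides_in D p 1"
    using p by (auto simp: prime_element_of_def)
  obtain k where k: "v p = Fin k" using v_finite p0 by blast
  have dvd: "divides_in D p x \<longleftrightarrow> v p \<le> v x" for x
  proof -
    have "divides_in D p x \<longleftrightarrow> x * inverse p \<in> D"
      unfolding divides_in_def using p0 by (auto simp: field_simps intro!: bexI[of _ "x * inverse p"])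
    then show ?thesis
      by (cases "v x") (auto simp: D_eq v_mult v_inverse[OF p0] k zero_extended_def)
  qed
  have k1: "1 \<le> k" using nu dvd[of 1] k v_one by (simp add: zero_extended_def)
  obtain t where t: "v t = Fin 1" and t0: "t \<noteq> 0" using v_range by (metis DiffD2 imageE rangeI singletonI)
  have tD: "t \<in> D" using t by (simp add: D_eq zero_extended_def)
  define q where "q = p * inverse t"
  have q: "v q = Fin (k - 1)" by (simp add: q_def v_mult k v_inverse[OF t0] t)
  have "q \<in> D" using q k1 by (simp add: D_eq zero_extended_def)
  moreover have "divides_in D p (t * q)"
    unfolding dvd v_mult q t k by simp
  ultimately have "divides_in D p t \<or> divides_in D p q"
    using p tD by (auto simp: prime_element_of_def)
  then have "k = 1" using k1 by (auto simp: dvd k t q)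
  then show ?thesis by (simp add: k one_extended_def)
qed

lemma non_zero_divisors_eichler_order:
  assumes "p \<in> D" "p \<noteq> 0"
  shows "non_zero_divisors (eichler_order D p n) = {A \<in> eichler_order D p n. det A \<noteq> 0}"
proof (rule Set.set_eqI, rule iffI)
  fix A assume A: "A \<in> non_zero_divisors (eichler_order D p n)"
  define B :: "'k^2^2" where
    "B = vector [vector [A$2$2, - A$1$2], vector [- A$2$1, A$1$1]]"
  have AR: "A \<in> eichler_order D p n" using A by (simp add: non_zero_divisors_def)
  then obtain b where b: "b \<in> D" "A$1$2 = b * p ^ n" by (auto simp: eichler_order_def)
  have "B \<in> eichler_order D p n"
  proof -
    have "B$1$2 = (- b) * p ^ n" by (simp add: B_def b)
    moreover have "B$i$j \<in> D" for i j
    proof -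
      have "A$i$j \<in> D" for i j using AR by (simp add: eichler_order_def)
      then show ?thesis
        using D_minus exhaust_2[of i] exhaust_2[of j] unfolding B_def by (elim disjE) simp_all
    qed
    ultimately show ?thesis using D_minus[OF b(1)] unfolding eichler_order_def by blast
  qed
  moreover have AB: "A ** B = 0" if "det A = 0"
  proof -
    have "A$1$1 * A$2$2 = A$1$2 * A$2$1" using that by (simp add: det_2)
    then show ?thesis
      unfolding B_def
      by (simp add: vec_eq_iff forall_2 matrix_matrix_mult_def sum_2 algebra_simps)
  qed
  ultimately have B0: "B = 0" if "det A = 0"
    using A that unfolding non_zero_divisors_def by blast
  have A0: "A = 0" if "det A = 0"
    using B0[OF that] unfolding B_def by (simp add: vec_eq_iff forall_2)
  have "(mat 1 :: 'k^2^2) \<in> eichler_order D p n"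
    using D_zero D_one by (auto simp: eichler_order_def mat_def forall_2 intro!: bexI[of _ 0])
  moreover have "(mat 1 :: 'k^2^2) \<noteq> 0" by (simp add: vec_eq_iff forall_2 mat_def)
  ultimately have "det A \<noteq> 0"
    using A A0 matrix_mul_rid[of A] unfolding non_zero_divisors_def by fastforce
  then show "A \<in> {A \<in> eichler_order D p n. det A \<noteq> 0}" using AR by simp
next
  fix A assume A: "A \<in> {A \<in> eichler_order D p n. det A \<noteq> 0}"
  then have "invertible A" by (simp add: invertible_det_nz)
  then obtain B where B: "A ** B = mat 1" "B ** A = mat 1" unfolding invertible_def by blast
  have zero: "Y ** 0 = 0" "0 ** Y = 0" for Y :: "'k^2^2"
    by (simp_all add: vec_eq_iff matrix_matrix_mult_def)
  have "X = 0" if "A ** X = 0" for X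
  proof -
    have "X = (B ** A) ** X" by (simp only: B matrix_mul_lid)
    also have "\<dots> = B ** (A ** X)" by (rule matrix_mul_assoc[symmetric])
    finally show ?thesis by (simp only: that zero)
  qed
  moreover have "X = 0" if "X ** A = 0" for X
  proof -
    have "X = X ** (A ** B)" by (simp only: B matrix_mul_rid)
    also have "\<dots> = (X ** A) ** B" by (rule matrix_mul_assoc)
    finally show ?thesis by (simp only: that zero)
  qed
  ultimately have "\<forall>X. (A ** X = 0 \<longrightarrow> X = 0) \<and> (X ** A = 0 \<longrightarrow> X = 0)" by blast
  then show "A \<in> non_zero_divisors (eichler_order D p n)"
    using A unfolding non_zero_divisors_def by blast
qed

lemma monoid_eichler_order:
  assumes "p \<in> D" "p \<noteq> 0"
  shows "monoid (non_zero_divisor_monoid (eichler_order D p n))"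
proof -
  have "mat 1 \<in> eichler_order D p n"
    using D_zero D_one by (auto simp: eichler_order_def mat_def forall_2 intro!: bexI[of _ 0])
  moreover have "A ** B \<in> eichler_order D p n"
    if A: "A \<in> eichler_order D p n" and B: "B \<in> eichler_order D p n" for A B
  proof -
    obtain a b where ab: "a \<in> D" "A$1$2 = a * p ^ n" "b \<in> D" "B$1$2 = b * p ^ n"
      using A B by (auto simp: eichler_order_def)
    have "(A ** B)$1$2 = (A$1$1 * b + a * B$2$2) * p ^ n"
      by (simp add: matrix_matrix_mult_def sum_2 ab algebra_simps)
    moreover have "A$1$1 * b + a * B$2$2 \<in> D"
      using A B ab D_mult D_add by (simp add: eichler_order_def)
    moreover have "(A ** B)$i$j \<in> D" for i j
      using A B D_mult D_add by (simp add: eichler_order_def matrix_matrix_mult_def sum_2)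
    ultimately show ?thesis unfolding eichler_order_def by blast
  qed
  ultimately show ?thesis
    by (intro monoidI)
       (auto simp: non_zero_divisor_monoid_def non_zero_divisors_eichler_order[OF assms]
         det_mul matrix_mul_assoc)
qed

end

end

theory Submission
  imports Defs
begin

text \<open>
  Units of \<open>R\<^sup>\<bullet>\<close> are the matrices of determinant valuation \<open>0\<close>, so determinant valuation \<open>1\<close>
  forces an atom. In case (II), reducing a product modulo \<open>\<pi>\<close> shows that one factor has both
  diagonal entries invertible. Conversely, let the determinant have valuation at least \<open>2\<close>. If a
  diagonal entry is a unit, eliminating the entry \<open>b\<pi>\<^sup>n\<close> with it splits off a triangular
  factor of determinant \<open>\<pi>\<close>; if neither is, but \<open>\<pi>\<close> divides \<open>b\<close> or \<open>c\<close>, then \<open>\<pi>\<close> divides a whole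
  row, and \<open>diag(\<pi>, 1)\<close> or \<open>diag(1, \<pi>)\<close> splits off.
\<close>

section \<open>Matrices of the Eichler order in coordinates\<close>

definition eichler_matrix :: "'k::field \<Rightarrow> nat \<Rightarrow> 'k \<Rightarrow> 'k \<Rightarrow> 'k \<Rightarrow> 'k \<Rightarrow> 'k^2^2" where
  "eichler_matrix p n a b c d = vector [vector [a, b * p ^ n], vector [c, d]]"

text \<open>Both summands of the upper right entry carry the factor \<open>p ^ n\<close>, so a
  product is again in coordinates, without any division by \<open>p\<close>.\<close>

lemma eichler_matrix_mult:
  "eichler_matrix p n a b c d ** eichler_matrix p n a' b' c' d' =
     eichler_matrix p n (a * a' + b * c' * p ^ n) (a * b' + b * d')
       (c * a' + d * c') (c * b' * p ^ n + d * d')"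
  by (simp add: eichler_matrix_def vec_eq_iff forall_2 matrix_matrix_mult_def sum_2 algebra_simps)

lemma det_eichler_matrix: "det (eichler_matrix p n a b c d) = a * d - b * c * p ^ n"
  by (simp add: eichler_matrix_def det_2 algebra_simps)

lemma eichler_matrix_eq_iff:
  assumes "p \<noteq> 0"
  shows "eichler_matrix p n a b c d = eichler_matrix p n a' b' c' d' \<longleftrightarrow>
    a = a' \<and> b = b' \<and> c = c' \<and> d = d'"
  using assms by (auto simp: eichler_matrix_def vec_eq_iff forall_2)

lemma mat_1_eq_eichler_matrix: "mat 1 = eichler_matrix p n 1 0 0 1"
  by (simp add: eichler_matrix_def vec_eq_iff forall_2 mat_def)

text \<open>Here \<open>D\<close> is a bare set, so \<open>b * p ^ n \<in> D\<close> is an explicit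
  premise; \<open>M_in_order\<close> discharges it for a valuation ring.\<close>

lemma eichler_matrix_in_eichler_order:
  "a \<in> D \<Longrightarrow> b * p ^ n \<in> D \<Longrightarrow> b \<in> D \<Longrightarrow> c \<in> D \<Longrightarrow> d \<in> D \<Longrightarrow>
    eichler_matrix p n a b c d \<in> eichler_order D p n"
  by (auto simp: eichler_order_def eichler_matrix_def forall_2)

lemma eichler_orderE:
  assumes "A \<in> eichler_order D p n"
  obtains a b c d where "a \<in> D" "b \<in> D" "c \<in> D" "d \<in> D" "A = eichler_matrix p n a b c d"
proof -
  obtain b where "b \<in> D" "A $ 1 $ 2 = b * p ^ n"
    using assms by (auto simp: eichler_order_def)
  moreover from this have "A = eichler_matrix p n (A $ 1 $ 1) b (A $ 2 $ 1) (A $ 2 $ 2)"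
    by (simp add: eichler_matrix_def vec_eq_iff forall_2)
  moreover have "A $ i $ j \<in> D" for i j
    using assms by (simp add: eichler_order_def)
  ultimately show thesis
    using that by blast
qed

section \<open>Arithmetic of the valuation\<close>

context discrete_valuation_ring
begin

lemma mem_D_iff: "x \<in> D \<longleftrightarrow> 0 \<le> v x"
  by (simp add: D_eq)

lemma D_power: "x \<in> D \<Longrightarrow> x ^ k \<in> D"
  by (induction k) (auto intro: D_one D_mult)

lemma v_add_pos: "0 < v x \<Longrightarrow> 0 < v y \<Longrightarrow> 0 < v (x + y)"
  using v_add[of x y] by (auto simp: min_def split: if_splits)

text \<open>Writing \<open>x\<close> as \<open>(x + y) + (- y)\<close> gives the reverse inequality:
  the minimum there cannot be \<open>v y\<close>, which exceeds \<open>v x\<close>.\<close>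

lemma v_add_eq:
  assumes "v x < v y"
  shows "v (x + y) = v x"
proof -
  have "v x \<le> v (x + y)"
    using v_add[of x y] assms by (simp add: min_def split: if_splits)
  moreover have "min (v (x + y)) (v y) \<le> v x"
    using v_add[of "x + y" "- y"] by (simp add: v_minus)
  ultimately show ?thesis
    using assms by (auto simp: min_def split: if_splits)
qed

lemma v_mult_eq_0_iff:
  assumes "x \<in> D" "y \<in> D"
  shows "v (x * y) = 0 \<longleftrightarrow> v x = 0 \<and> v y = 0"
  using assms by (cases "v x"; cases "v y") (auto simp: D_eq v_mult zero_extended_def)

lemma v_mult_eq_1:
  assumes "x \<in> D" "y \<in> D" "v (x * y) = 1"
  shows "v x = 0 \<or> v y = 0"
  using assms
  by (cases "v x"; cases "v y") (auto simp: D_eq v_mult zero_extended_def one_extended_def)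

lemma v_mult_pos:
  assumes "x \<in> D" "y \<in> D" "0 < v x \<or> 0 < v y"
  shows "0 < v (x * y)"
  using assms v_mult_eq_0_iff[of x y] D_mult[of x y] by (auto simp: mem_D_iff less_le)

lemma inverse_in_D:
  assumes "v x = 0"
  shows "inverse x \<in> D"
proof -
  have "x \<noteq> 0" using assms by (auto simp: v_zero zero_extended_def)
  then show ?thesis using assms by (simp add: D_eq v_inverse) (simp add: zero_extended_def)
qed

lemma pos_v_E:
  assumes "v p = 1" "0 < v x"
  obtains y where "y \<in> D" "x = p * y"
proof -
  have p: "p \<noteq> 0" using assms by (auto simp: v_zero one_extended_def)
  have "x * inverse p \<in> D"
    using assms by (cases "v x") (auto simp: D_eq v_mult v_inverse[OF p] zero_extended_def one_extended_def)
  then show thesis using that[of "x * inverse p"] p by simp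
qed

text \<open>Once a determinant \<open>p * s\<close> has valuation at least 2, splitting off
  \<open>p\<close> leaves a cofactor \<open>s\<close> that is still a non-unit.\<close>

lemma v_p_mult_pos:
  assumes "v p = 1" "0 < v (p * y)" "v (p * y) \<noteq> 1"
  shows "0 < v y"
  using assms by (cases "v y") (auto simp: v_mult zero_extended_def one_extended_def)

text \<open>This is where \<open>n \<ge> 2\<close> enters: the term \<open>b * c * p ^ n\<close> of
  the determinant is too small to affect the valuations 0 and 1.\<close>

lemma v_p_power_mult:
  assumes p: "v p = 1" and n: "n \<ge> 2" and x: "x \<in> D"
  shows "1 < v (x * p ^ n)"
proof -
  obtain m where m: "n = Suc (Suc m)" using n by (metis Suc_le_D numeral_2_eq_2 Suc_le_mono)
  have "p \<in> D" using p by (simp add: D_eq zero_extended_def one_extended_def)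
  then have "x * p ^ m \<in> D" using x by (intro D_mult D_power)
  moreover have "x * p ^ n = p * (p * (x * p ^ m))" by (simp add: m)
  then have "v (x * p ^ n) = 1 + (1 + v (x * p ^ m))" by (simp only: v_mult p)
  ultimately show ?thesis
    by (cases "v (x * p ^ m)") (simp_all add: D_eq zero_extended_def one_extended_def)
qed

end

section \<open>Determinants and units of the monoid\<close>

locale eichler = discrete_valuation_ring D v for D :: "'k::field set" and v +
  fixes p :: 'k and n :: nat
  assumes v_p: "v p = 1" and n_ge_2: "n \<ge> 2"
begin

abbreviation "M \<equiv> eichler_matrix p n"
abbreviation "H \<equiv> non_zero_divisor_monoid (eichler_order D p n)"

lemma p_in_D: "p \<in> D" and p_nonzero: "p \<noteq> 0"
  using v_p by (auto simp: D_eq v_zero zero_extended_def one_extended_def)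

lemma zero_less_one_extended: "(0 :: int extended) < 1"
  by (simp add: zero_extended_def one_extended_def)

lemma carrier_H: "A \<in> carrier H \<longleftrightarrow> A \<in> eichler_order D p n \<and> det A \<noteq> 0"
  by (simp add: non_zero_divisor_monoid_def non_zero_divisors_eichler_order[OF p_in_D p_nonzero])

lemma mult_H: "A \<otimes>\<^bsub>H\<^esub> B = A ** B"
  by (simp add: non_zero_divisor_monoid_def)

lemma one_H: "\<one>\<^bsub>H\<^esub> = mat 1"
  by (simp add: non_zero_divisor_monoid_def)

lemma M_in_order: "a \<in> D \<Longrightarrow> b \<in> D \<Longrightarrow> c \<in> D \<Longrightarrow> d \<in> D \<Longrightarrow> M a b c d \<in> eichler_order D p n"
  by (intro eichler_matrix_in_eichler_order D_mult D_power p_in_D)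

lemma det_in_D:
  assumes "A \<in> eichler_order D p n"
  shows "det A \<in> D"
  using assms
  by (elim eichler_orderE)
     (auto simp: det_eichler_matrix diff_conv_add_uminus
        intro!: D_add D_minus D_mult D_power p_in_D simp del: add_uminus_conv_diff)

text \<open>The determinant and \<open>a * d\<close> differ by a term of valuation above 1, so
  \<open>v_add_eq\<close> transfers a value \<open>k \<le> 1\<close> from either one to the
  other.\<close>

lemma v_det_M_iff:
  assumes "b \<in> D" "c \<in> D" "k \<le> 1"
  shows "v (det (M a b c d)) = k \<longleftrightarrow> v (a * d) = k"
proof -
  have big: "k < v (b * c * p ^ n)"
    using v_p_power_mult[OF v_p n_ge_2, of "b * c"] assms D_mult by fastforce
  show ?thesis
    using v_add_eq[of "a * d" "- (b * c * p ^ n)"] v_add_eq[of "a * d - b * c * p ^ n" "b * c * p ^ n"] big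
    by (auto simp: det_eichler_matrix v_minus)
qed

lemma Units_H: "A \<in> Units H \<longleftrightarrow> A \<in> eichler_order D p n \<and> v (det A) = 0"
proof
  assume "A \<in> Units H"
  then obtain B where B: "A \<in> eichler_order D p n" "B \<in> eichler_order D p n" "B ** A = mat 1"
    by (auto simp: Units_def carrier_H mult_H one_H)
  have "det B * det A = 1" using B(3) by (metis det_mul det_I)
  then have "v (det B * det A) = 0" by (simp add: v_one)
  then show "A \<in> eichler_order D p n \<and> v (det A) = 0"
    using B det_in_D v_mult_eq_0_iff by blast
next
  assume A: "A \<in> eichler_order D p n \<and> v (det A) = 0"
  then obtain a b c d where abcd: "a \<in> D" "b \<in> D" "c \<in> D" "d \<in> D" and eq: "A = M a b c d"
    by (auto elim: eichler_orderE)
  define e where "e = inverse (det A)"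
  have det0: "det A \<noteq> 0" using A by (auto simp: v_zero zero_extended_def)
  have e: "e \<in> D" unfolding e_def using A inverse_in_D by blast
  \<comment> \<open>The adjugate divided by the determinant; it keeps the factor
    \<open>p ^ n\<close> in the upper right entry, so it stays in the order.\<close>
  define B where "B = M (e * d) (- e * b) (- e * c) (e * a)"
  have one: "e * (a * d - b * c * p ^ n) = 1"
    using det0 by (simp add: e_def eq det_eichler_matrix)
  have AB: "A ** B = mat 1" "B ** A = mat 1"
    using one unfolding eq B_def mat_1_eq_eichler_matrix[of p n] eichler_matrix_mult
      eichler_matrix_eq_iff[OF p_nonzero]
    by (simp_all add: algebra_simps)
  have "B \<in> eichler_order D p n"
    unfolding B_def by (intro M_in_order D_mult D_minus e abcd)
  moreover have "det B \<noteq> 0" using AB(1) by (metis det_mul det_I mult_zero_right zero_neq_one)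
  ultimately show "A \<in> Units H"
    using A det0 AB by (auto simp: Units_def carrier_H mult_H one_H)
qed

text \<open>Modulo \<open>p\<close> the determinant is \<open>a * d\<close>, so invertibility can be
  read off the diagonal.\<close>

lemma Units_M:
  assumes "a \<in> D" "b \<in> D" "c \<in> D" "d \<in> D"
  shows "M a b c d \<in> Units H \<longleftrightarrow> v a = 0 \<and> v d = 0"
  using assms zero_less_one_extended
  by (simp add: Units_H M_in_order v_det_M_iff v_mult_eq_0_iff)

section \<open>The two types of atoms\<close>

lemma atom_if_v_det_1:
  assumes A: "A \<in> carrier H" and v1: "v (det A) = 1"
  shows "monoid_atom H A"
  unfolding monoid_atom_def
proof (intro conjI ballI impI)
  show "A \<in> carrier H - Units H"
    using A v1 zero_less_one_extended by (auto simp: Units_H)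
  fix X Y assume X: "X \<in> carrier H" and Y: "Y \<in> carrier H" and "A = X \<otimes>\<^bsub>H\<^esub> Y"
  then have "v (det X * det Y) = 1" using v1 by (simp add: mult_H det_mul)
  then show "X \<in> Units H \<or> Y \<in> Units H"
    using X Y det_in_D v_mult_eq_1 unfolding carrier_H Units_H by blast
qed

lemma atom_if_antidiagonal_units:
  assumes abcd: "a \<in> D" "b \<in> D" "c \<in> D" "d \<in> D"
    and A: "M a b c d \<in> carrier H"
    and b: "v b = 0" and c: "v c = 0" and a: "0 < v a" and d: "0 < v d"
  shows "monoid_atom H (M a b c d)"
  unfolding monoid_atom_def
proof (intro conjI ballI impI)
  show "M a b c d \<in> carrier H - Units H"
    using A abcd a by (auto simp: Units_M)
  fix X Y assume X: "X \<in> carrier H" and Y: "Y \<in> carrier H" and eq: "M a b c d = X \<otimes>\<^bsub>H\<^esub> Y"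
  obtain x1 x2 x3 x4 where x: "x1 \<in> D" "x2 \<in> D" "x3 \<in> D" "x4 \<in> D" and Xe: "X = M x1 x2 x3 x4"
    using X by (auto simp: carrier_H elim: eichler_orderE)
  obtain y1 y2 y3 y4 where y: "y1 \<in> D" "y2 \<in> D" "y3 \<in> D" "y4 \<in> D" and Ye: "Y = M y1 y2 y3 y4"
    using Y by (auto simp: carrier_H elim: eichler_orderE)
  have e: "a = x1 * y1 + x2 * y3 * p ^ n" "b = x1 * y2 + x2 * y4"
    "c = x3 * y1 + x4 * y3" "d = x3 * y2 * p ^ n + x4 * y4"
    using eq by (auto simp: Xe Ye mult_H eichler_matrix_mult eichler_matrix_eq_iff[OF p_nonzero])
  \<comment> \<open>The sign is chosen so that adding such a term to \<open>a\<close> or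
    \<open>d\<close> leaves the diagonal product \<open>x1 * y1\<close> or
    \<open>x4 * y4\<close>.\<close>
  have pn: "0 < v (- (z * p ^ n))" if "z \<in> D" for z
    using v_p_power_mult[OF v_p n_ge_2 that] zero_less_one_extended by (simp add: v_minus)
  have "0 < v (x1 * y1)"
    using v_add_pos[OF a pn[of "x2 * y3"]] x y by (simp add: e(1) D_mult)
  then have xy1: "v x1 \<noteq> 0 \<or> v y1 \<noteq> 0" using x y v_mult_eq_0_iff by fastforce
  have "0 < v (x4 * y4)"
    using v_add_pos[OF d pn[of "x3 * y2"]] x y by (simp add: e(4) D_mult)
  then have xy4: "v x4 \<noteq> 0 \<or> v y4 \<noteq> 0" using x y v_mult_eq_0_iff by fastforce
  \<comment> \<open>\<open>D\<close> is local: a sum of non-units is a non-unit, so a unit sum has a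
    unit summand, both of whose factors are units.\<close>
  have unit_summand: "v r = 0 \<and> v s = 0 \<or> v t = 0 \<and> v u = 0"
    if "r \<in> D" "s \<in> D" "t \<in> D" "u \<in> D" "v (r * s + t * u) = 0" for r s t u
  proof -
    have "v (r * s) = 0 \<or> v (t * u) = 0"
      using v_add_pos[of "r * s" "t * u"] that D_mult by (fastforce simp: mem_D_iff less_le)
    then show ?thesis using that v_mult_eq_0_iff by blast
  qed
  have "v x1 = 0 \<and> v y2 = 0 \<or> v x2 = 0 \<and> v y4 = 0"
    using unit_summand[of x1 y2 x2 y4] x y b by (simp add: e(2))
  moreover have "v x3 = 0 \<and> v y1 = 0 \<or> v x4 = 0 \<and> v y3 = 0"
    using unit_summand[of x3 y1 x4 y3] x y c by (simp add: e(3))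
  \<comment> \<open>If \<open>x1\<close> is a unit, then \<open>y1\<close> is not, so the condition
    from \<open>c\<close> makes \<open>x4\<close> a unit and \<open>X\<close> invertible. Otherwise
    \<open>y4\<close> is a unit, hence \<open>x4\<close> is not, and \<open>y1\<close> is a unit, so
    \<open>Y\<close> is invertible.\<close>
  ultimately show "X \<in> Units H \<or> Y \<in> Units H"
    using xy1 xy4 x y by (auto simp: Xe Ye Units_M)
qed

text \<open>The determinant of such an atom has valuation at least 2, so a factorization with one
  factor of determinant \<open>p\<close> is contradictory. Each way of violating the conclusion
  yields one.\<close>

lemma atom_cases:
  assumes abcd: "a \<in> D" "b \<in> D" "c \<in> D" "d \<in> D"
    and atom: "monoid_atom H (M a b c d)" and v1: "v (det (M a b c d)) \<noteq> 1"
  shows "v b = 0 \<and> v c = 0 \<and> 0 < v a \<and> 0 < v d"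
proof -
  define t where "t = det (M a b c d)"
  have AH: "M a b c d \<in> eichler_order D p n" and t0: "t \<noteq> 0"
    using atom by (auto simp: monoid_atom_def carrier_H t_def)
  have vt: "0 < v t"
    using atom det_in_D[OF AH] AH by (auto simp: t_def monoid_atom_def Units_H mem_D_iff less_le)
  then obtain s where s: "s \<in> D" "t = p * s" using pos_v_E[OF v_p] by blast
  have vs: "0 < v s" using v_p_mult_pos[OF v_p, of s] vt v1 s(2) t_def by simp
  \<comment> \<open>The other factor has determinant \<open>s\<close>, again of positive valuation,
    so neither factor is a unit.\<close>
  have no_split: False
    if X: "X \<in> eichler_order D p n" and Y: "Y \<in> eichler_order D p n"
      and eq: "M a b c d = X ** Y" and det: "det X = p \<or> det Y = p" for X Y
  proof -
    have "det X * det Y = p * s" using eq s(2) by (simp add: t_def det_mul)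
    then have "det X = p \<and> det Y = s \<or> det X = s \<and> det Y = p"
      using det p_nonzero by (auto simp: mult.commute)
    moreover have "0 < v p" using v_p zero_less_one_extended by simp
    ultimately have "0 < v (det X)" "0 < v (det Y)" using vs by auto
    then have "X \<in> carrier H - Units H" "Y \<in> carrier H - Units H"
      using X Y \<open>det X * det Y = p * s\<close> s(2) t0 by (auto simp: carrier_H Units_H)
    then show False using atom eq by (auto simp: monoid_atom_def mult_H)
  qed
  have det: "p * s = a * d - b * c * p ^ n" using s(2) t_def by (simp add: det_eichler_matrix)
  have a: "0 < v a"
  proof (rule ccontr)
    assume "\<not> 0 < v a"
    then have va: "v a = 0" using abcd by (auto simp: mem_D_iff)
    then have a0: "a \<noteq> 0" by (auto simp: v_zero zero_extended_def)
    \<comment> \<open>Column elimination with pivot \<open>a\<close>; the entry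
      \<open>s * inverse a\<close> is forced by \<open>det\<close>. The right factor has determinant
      \<open>p\<close>.\<close>
    have "M a b c d = M a 0 c (s * inverse a) ** M 1 (b * inverse a) 0 p"
      using a0 det by (simp add: eichler_matrix_mult eichler_matrix_eq_iff[OF p_nonzero] field_simps)
    then show False
      using no_split[of "M a 0 c (s * inverse a)" "M 1 (b * inverse a) 0 p"] va abcd s
      by (simp add: M_in_order D_mult inverse_in_D D_zero D_one p_in_D det_eichler_matrix)
  qed
  have d: "0 < v d"
  proof (rule ccontr)
    assume "\<not> 0 < v d"
    then have vd: "v d = 0" using abcd by (auto simp: mem_D_iff)
    then have d0: "d \<noteq> 0" by (auto simp: v_zero zero_extended_def)
    \<comment> \<open>The mirror image: row elimination with pivot \<open>d\<close>, now with the
      factor of determinant \<open>p\<close> on the left.\<close>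
    have "M a b c d = M p (b * inverse d) 0 1 ** M (s * inverse d) 0 c d"
      using d0 det by (simp add: eichler_matrix_mult eichler_matrix_eq_iff[OF p_nonzero] field_simps)
    then show False
      using no_split[of "M p (b * inverse d) 0 1" "M (s * inverse d) 0 c d"] vd abcd s
      by (simp add: M_in_order D_mult inverse_in_D D_zero D_one p_in_D det_eichler_matrix)
  qed
  obtain a' d' where ad: "a' \<in> D" "a = p * a'" "d' \<in> D" "d = p * d'"
    using pos_v_E[OF v_p] a d by metis
  have "v b = 0"
  proof (rule ccontr)
    assume "v b \<noteq> 0"
    then obtain b' where b': "b' \<in> D" "b = p * b'"
      using pos_v_E[OF v_p, of b] abcd by (auto simp: mem_D_iff less_le)
    \<comment> \<open>The first row is divisible by \<open>p\<close>. Divisibility of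
      \<open>b\<close> itself, not just of \<open>b * p ^ n\<close>, keeps the quotient matrix in
      the order.\<close>
    show False
      using no_split[of "M p 0 0 1" "M a' b' c d"] abcd ad b'
      by (simp add: M_in_order D_zero D_one p_in_D det_eichler_matrix eichler_matrix_mult)
  qed
  moreover have "v c = 0"
  proof (rule ccontr)
    assume "v c \<noteq> 0"
    then obtain c' where c': "c' \<in> D" "c = p * c'"
      using pos_v_E[OF v_p, of c] abcd by (auto simp: mem_D_iff less_le)
    \<comment> \<open>Here the second row is divisible by \<open>p\<close>, since
      \<open>d = p * d'\<close> as well.\<close>
    show False
      using no_split[of "M 1 0 0 p" "M a b c' d'"] abcd ad c'
      by (simp add: M_in_order D_zero D_one p_in_D det_eichler_matrix eichler_matrix_mult)
  qed
  ultimately show ?thesis using a d by blast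
qed

end

theorem theorem4p8:
  fixes D :: "'k::field set" and v :: "'k \<Rightarrow> int extended"
    and \<pi> a b c d :: 'k and n :: nat and A :: "'k^2^2"
  assumes "discrete_valuation_ring D v"
    and "prime_element_of D \<pi>"
    and "n \<ge> 2"
    and "a \<in> D" "b \<in> D" "c \<in> D" "d \<in> D"
    and "A = vector [vector [a, b * \<pi> ^ n], vector [c, d]]"
    and "A \<in> non_zero_divisors (eichler_order D \<pi> n)"
  shows "(monoid_atom (non_zero_divisor_monoid (eichler_order D \<pi> n)) A \<longleftrightarrow>
           v (det A) = 1 \<or> (v b = 0 \<and> v c = 0 \<and> v a > 0 \<and> v d > 0)) \<and>
         (v (det A) = 1 \<longleftrightarrow> v (a * d) = 1)"
proof -
  interpret discrete_valuation_ring D v by fact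
  interpret eichler D v \<pi> n
    by unfold_locales (use assms v_prime_element in auto)
  have A: "A = M a b c d" using assms(8) by (simp add: eichler_matrix_def)
  have AH: "A \<in> carrier H" using assms(9) by (simp add: non_zero_divisor_monoid_def)
  \<comment> \<open>\<open>v_det_M_iff\<close> at \<open>k = 1\<close> gives the second conjunct;
    for the first, \<open>atom_cases\<close> covers the atoms whose determinant does not have
    valuation 1.\<close>
  show ?thesis
    using atom_if_v_det_1[OF AH] atom_if_antidiagonal_units[OF assms(4-7)] atom_cases[OF assms(4-7)]
      v_det_M_iff[OF assms(5,6), of 1] AH
    unfolding A by blast
qed

end
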